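(* Let $\gamma^+>0$. Assume that $\{P_\theta,\theta\in\Theta\}$ and $\{\phi_\gamma:\Theta\times\mathsf{X}\to\Theta,\ \gamma\in(0,\gamma^+]\}$ satisfy the assumptions (A2) and (A3) described in the context. Then for any $\varepsilon\in(0,\Delta(0))$ there exist $\lambda_*\in[1,\infty)$ and $\delta,M_*\in(0,+\infty)$ such that for any $(\gamma,\bar\gamma)\in\Gamma_\varepsilon$ and any $(\theta,x)\in\Theta\times\mathsf{X}$ with $(\theta,x)\notin\mathcal{W}_{M_*}\times\mathsf{C}$, $$P_{\theta,\gamma}\{\lambda_*V+w/\gamma\}(\theta,x)\le\lambda_*V(x)+w(\theta)/\bar\gamma-\delta\left[V^\iota(x)/a(\theta)+w(\theta)\right].$$
   Context: Setting: $\mathsf{X}\subset\mathbb{R}^{n_x}$, $\Theta\subset\mathbb{R}^{n_\theta}$, $\{P_\theta,\theta\in\Theta\}$ is a family of Markov transition probabilities on $(\mathsf{X},\mathcal{B}(\mathsf{X}))$, and $P_\theta f(x):=\int_{\mathsf{X}}P_\theta(x,\mathrm{d}y)f(y)$. For $f$ defined on $\Theta\times\mathsf{X}$, $P_{\theta,\gamma}f(\theta,x):=\int_{\mathsf{X}}P_\theta(x,\mathrm{d}y)f(\phi_\gamma(\theta,y),y)$; functions of $\theta$ only or of $x$ only are viewed as functions on $\Theta\times\mathsf{X}$. $\mathcal{W}_M:=\{\theta\in\Theta:w(\theta)\le M\}$, $A^c$ denotes the complement of $A$, $a^{-1}(\theta):=1/a(\theta)$ (similarly $e^{-p}(\theta)=e(\theta)^{-p}$),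 $u\vee v:=\max\{u,v\}$, and $$\Gamma_\varepsilon:=\{(\gamma,\bar\gamma)\in(0,\gamma^+]^2:\gamma^{-1}-\bar\gamma^{-1}<\Delta(0)-\varepsilon\}.$$ Assumption (A2): there exist $V:\mathsf{X}\to[1,\infty)$ and $\mathsf{C}\subset\mathsf{X}$ with $\sup_{x\in\mathsf{C}}V(x)<\infty$, functions $a,b:\Theta\to[0,\infty)$ and $\iota\in[0,1]$ such that for all $(\theta,x)\in\Theta\times\mathsf{X}$, $$P_\theta V(x)\le[V(x)-a^{-1}(\theta)V^\iota(x)]\mathbb{I}\{x\notin\mathsf{C}\}+b(\theta)\mathbb{I}\{x\in\mathsf{C}\}.$$ Assumption (A3): with $V,\mathsf{C},a,b,\iota$ as in (A2), there exists $w:\Theta\to[1,\infty)$ such that: (1) for any $M>0$, $\sup_{\theta\in\mathcal{W}_M}a(\theta)<\infty$, and $\lim_{M\to\infty}\sup_{\theta\in\mathcal{W}_M^c}b(\theta)/w(\theta)=0$; (2) there exist $\beta\in[0,1]$, $c,d:\Theta\to[0,\infty)$ and $e:\Theta\to[1,\infty)$ such that for all $\gamma\in(0,\gamma^+]$ and $(\theta,x)\in\Theta\times\mathsf{X}$, $$P_{\theta,\gamma}w(\theta,x)\le w(\theta)-\gamma w(\theta)\Delta\left(V_\beta(\theta,x)\mathbb{I}\{x\notin\mathsf{C}\}+d(\theta)\mathbb{I}\{x\in\mathsf{C}\}\right),\quad V_\beta(\theta,x):=c(\theta)+V^\beta(x)/e(\theta);$$ (3) $c,d$ are bounded, $\lim_{M\to\infty}\sup_{\theta\in\mathcal{W}_M^c}[c(\theta)\vee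 d(\theta)]=0$, and for any $M>0$, $\sup_{\theta\in\mathcal{W}_M}e(\theta)<\infty$; (4) $\Delta:[0,\infty)\to\mathbb{R}$ is such that (a) $\Delta(0)>0$ and $\Delta$ is continuous in a neighborhood of $0$; (b) there exists $p_\Delta\in(0,\iota/\beta]$ such that for all $M>0$ there exists $C_{\Delta,M}>0$ with $|\Delta(z)|\le C_{\Delta,M}z^{p_\Delta}$ for all $z\ge M$; (5) for any $\epsilon>0$, $$\sup_{(\theta,x)\in\tilde{\mathcal{V}}_\epsilon}\frac{a(\theta)w(\theta)e^{-p_\Delta}(\theta)}{V^{\iota-p_\Delta\beta}(x)}<\infty,\qquad\tilde{\mathcal{V}}_\epsilon:=\{(\theta,x):V^\beta(x)/e(\theta)\ge\epsilon\}.$$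
   Formalization: The inclusion of C in X is taken to be strict (C ≠ X) and a(θ) > 0 is assumed so that 1/a is defined; for C = X assumption (A2) does not bound 1/a, and the claim can fail (e.g. V = 1, w(θ) = θ, a(θ) = 1/θ²). *)

theory Defs
  imports "HOL-Probability.Probability"
begin

definition markov_family ::
  "'t set \<Rightarrow> 'x::topological_space set \<Rightarrow> ('t \<Rightarrow> 'x \<Rightarrow> 'x measure) \<Rightarrow> bool"
where
  "markov_family \<Theta> X P \<longleftrightarrow>
     (\<forall>\<theta>\<in>\<Theta>. P \<theta> \<in> restrict_space borel X \<rightarrow>\<^sub>M prob_algebra (restrict_space borel X))"

definition kernel_op ::
  "('t \<Rightarrow> 'x \<Rightarrow> 'x measure) \<Rightarrow> 't \<Rightarrow> ('x \<Rightarrow> real) \<Rightarrow> 'x \<Rightarrow> real"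
where
  "kernel_op P \<theta> f x = (\<integral>y. f y \<partial>P \<theta> x)"

definition controlled_op ::
  "('t \<Rightarrow> 'x \<Rightarrow> 'x measure) \<Rightarrow> (real \<Rightarrow> 't \<Rightarrow> 'x \<Rightarrow> 't) \<Rightarrow> real \<Rightarrow>
   ('t \<Rightarrow> 'x \<Rightarrow> real) \<Rightarrow> 't \<Rightarrow> 'x \<Rightarrow> real"
where
  "controlled_op P \<phi> \<gamma> f \<theta> x = (\<integral>y. f (\<phi> \<gamma> \<theta> y) y \<partial>P \<theta> x)"

definition sublevel :: "'t set \<Rightarrow> ('t \<Rightarrow> real) \<Rightarrow> real \<Rightarrow> 't set"
where
  "sublevel \<Theta> w M = {\<theta>\<in>\<Theta>. w \<theta> \<le> M}"

text \<open>
  The Bochner integral of a non-integrable function is 0, so an upper bound on the integral of a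
  nonnegative function has to be accompanied by integrability in order to mean what it says for
  an integral with values in \<open>[0,\<infinity>]\<close>.  Integrability also records the
  measurability without which the integral is not defined.

  Positivity of \<open>a\<close> makes its reciprocal a real-valued function: with \<open>1/0 = \<infinity>\<close>
  the inequality could not hold at any point outside \<open>C\<close>, whereas Isabelle's \<open>1/0 = 0\<close>
  would turn it into a weaker condition.

  The inclusion of \<open>C\<close> in \<open>X\<close> is strict: for \<open>C = X\<close> the inequality does not
  involve \<open>a\<close> at all, so nothing bounds the term \<open>V\<^sup>\<iota> / a\<close>.
\<close>

definition drift_x ::
  "'t set \<Rightarrow> 'x set \<Rightarrow> ('t \<Rightarrow> 'x \<Rightarrow> 'x measure) \<Rightarrow> ('x \<Rightarrow> real) \<Rightarrow> 'x set \<Rightarrow>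
   ('t \<Rightarrow> real) \<Rightarrow> ('t \<Rightarrow> real) \<Rightarrow> real \<Rightarrow> bool"
where
  "drift_x \<Theta> X P V C a b \<iota> \<longleftrightarrow>
     (\<forall>x\<in>X. 1 \<le> V x) \<and>
     C \<subset> X \<and> bdd_above (V ` C) \<and>
     (\<forall>\<theta>\<in>\<Theta>. 0 < a \<theta> \<and> 0 \<le> b \<theta>) \<and>
     0 \<le> \<iota> \<and> \<iota> \<le> 1 \<and>
     (\<forall>\<theta>\<in>\<Theta>. \<forall>x\<in>X. integrable (P \<theta> x) V \<and>
        kernel_op P \<theta> V x
          \<le> (V x - (1 / a \<theta>) * V x powr \<iota>) * indicator (- C) x + b \<theta> * indicator C x)"

definition V_beta ::
  "('x \<Rightarrow> real) \<Rightarrow> ('t \<Rightarrow> real) \<Rightarrow> ('t \<Rightarrow> real) \<Rightarrow> real \<Rightarrow> 't \<Rightarrow> 'x \<Rightarrow> real"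
where
  "V_beta V c e \<beta> \<theta> x = c \<theta> + V x powr \<beta> / e \<theta>"

text \<open>
  The suprema inside limits are taken in \<^typ>\<open>ennreal\<close>: they range over nonnegative
  quantities, may be infinite, and are 0 over the empty set (which occurs when \<open>w\<close> is bounded).
  The condition \<open>p \<le> \<iota> / \<beta>\<close> is written \<open>p * \<beta> \<le> \<iota>\<close>, so that for
  \<open>\<beta> = 0\<close> the upper bound is \<open>\<infinity>\<close> rather than Isabelle's \<open>\<iota> / 0 = 0\<close>.
\<close>

definition drift_theta ::
  "'t set \<Rightarrow> 'x set \<Rightarrow> ('t \<Rightarrow> 'x \<Rightarrow> 'x measure) \<Rightarrow> (real \<Rightarrow> 't \<Rightarrow> 'x \<Rightarrow> 't) \<Rightarrow> real \<Rightarrow>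
   ('x \<Rightarrow> real) \<Rightarrow> 'x set \<Rightarrow> ('t \<Rightarrow> real) \<Rightarrow> ('t \<Rightarrow> real) \<Rightarrow> real \<Rightarrow>
   ('t \<Rightarrow> real) \<Rightarrow> real \<Rightarrow> ('t \<Rightarrow> real) \<Rightarrow> ('t \<Rightarrow> real) \<Rightarrow> ('t \<Rightarrow> real) \<Rightarrow>
   (real \<Rightarrow> real) \<Rightarrow> real \<Rightarrow> bool"
where
  "drift_theta \<Theta> X P \<phi> \<gamma>max V C a b \<iota> w \<beta> c d e \<Delta> p \<longleftrightarrow>
     (\<forall>\<theta>\<in>\<Theta>. 1 \<le> w \<theta>) \<and>
     (\<forall>M>0. bdd_above (a ` sublevel \<Theta> w M)) \<and>
     ((\<lambda>M. SUP \<theta>\<in>\<Theta> - sublevel \<Theta> w M. ennreal (b \<theta> / w \<theta>)) \<longlongrightarrow> 0) at_top \<and>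
     0 \<le> \<beta> \<and> \<beta> \<le> 1 \<and>
     (\<forall>\<theta>\<in>\<Theta>. 0 \<le> c \<theta> \<and> 0 \<le> d \<theta> \<and> 1 \<le> e \<theta>) \<and>
     (\<forall>\<gamma>\<in>{0<..\<gamma>max}. \<forall>\<theta>\<in>\<Theta>. \<forall>x\<in>X.
        integrable (P \<theta> x) (\<lambda>y. w (\<phi> \<gamma> \<theta> y)) \<and>
        controlled_op P \<phi> \<gamma> (\<lambda>\<theta> x. w \<theta>) \<theta> x
          \<le> w \<theta> - \<gamma> * w \<theta> *
              \<Delta> (V_beta V c e \<beta> \<theta> x * indicator (- C) x + d \<theta> * indicator C x)) \<and>
     bounded (c ` \<Theta>) \<and> bounded (d ` \<Theta>) \<and>
     ((\<lambda>M. SUP \<theta>\<in>\<Theta> - sublevel \<Theta> w M. ennreal (max (c \<theta>) (d \<theta>))) \<longlongrightarrow> 0) at_top \<and>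
     (\<forall>M>0. bdd_above (e ` sublevel \<Theta> w M)) \<and>
     0 < \<Delta> 0 \<and> (\<exists>r>0. continuous_on {0..<r} \<Delta>) \<and>
     0 < p \<and> p * \<beta> \<le> \<iota> \<and>
     (\<forall>M>0. \<exists>K>0. \<forall>z\<ge>M. \<bar>\<Delta> z\<bar> \<le> K * z powr p) \<and>
     (\<forall>\<epsilon>>0. bdd_above
        ((\<lambda>(\<theta>, x). a \<theta> * w \<theta> * e \<theta> powr (- p) / V x powr (\<iota> - p * \<beta>))
          ` {(\<theta>, x) \<in> \<Theta> \<times> X. V x powr \<beta> / e \<theta> \<ge> \<epsilon>}))"

definition step_pairs :: "real \<Rightarrow> (real \<Rightarrow> real) \<Rightarrow> real \<Rightarrow> (real \<times> real) set"
where
  "step_pairs \<gamma>max \<Delta> \<epsilon> =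
     {(\<gamma>, \<gamma>'). \<gamma> \<in> {0<..\<gamma>max} \<and> \<gamma>' \<in> {0<..\<gamma>max} \<and> 1 / \<gamma> - 1 / \<gamma>' < \<Delta> 0 - \<epsilon>}"

end

theory Submission
  imports Defs
begin

text \<open>
  Multiplying the drift of \<open>w\<close> by \<open>1/\<gamma> < 1/\<gamma>' + \<Delta> 0 - \<epsilon>\<close> leaves the error term
  \<open>w (\<Delta> 0 - \<epsilon> - \<Delta> z)\<close>.  If \<open>z\<close> is so small that \<open>\<Delta> z > \<Delta> 0 - \<epsilon>/2\<close>, then this is at most
  \<open>- w \<epsilon>/2\<close>.  Otherwise, outside \<open>C\<close>, the ratio \<open>V\<^sup>\<beta> / e\<close> is bounded away from 0 (either it carries half
  of \<open>z\<close>, or \<open>c \<theta>\<close> is not small, which confines \<open>\<theta>\<close> to a sublevel set, where \<open>e\<close> is bounded), so the growth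
  bound on \<open>\<Delta>\<close> and condition (5) dominate the error by a multiple of \<open>V\<^sup>\<iota> / a\<close>, which the drift of
  \<open>L V\<close> absorbs.  On \<open>C\<close>, large \<open>w\<close> makes \<open>d\<close> and \<open>b / w\<close> small; there \<open>V\<^sup>\<iota> / a\<close> is bounded
  because the drift of \<open>V\<close> at a point outside \<open>C\<close> bounds \<open>1 / a\<close> uniformly.
\<close>

text \<open>Converts a limit of suprema in \<open>ennreal\<close> into a real threshold on
  \<open>w\<close> beyond which \<open>f\<close> is pointwise small. It is applied to
  \<open>b \<theta> / w \<theta>\<close> and to
  \<open>max (c \<theta>) (d \<theta>)\<close>.\<close>

lemma SUP_complement_sublevel_tendsto_0D:
  fixes f :: "'t \<Rightarrow> real"
  assumes "((\<lambda>M. SUP \<theta>\<in>\<Theta> - sublevel \<Theta> w M. ennreal (f \<theta>)) \<longlongrightarrow> 0) at_top" and "0 < \<kappa>"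
  shows "\<exists>M>0. \<forall>\<theta>\<in>\<Theta>. M < w \<theta> \<longrightarrow> f \<theta> < \<kappa>"
proof -
  have "\<forall>\<^sub>F M in at_top. (SUP \<theta>\<in>\<Theta> - sublevel \<Theta> w M. ennreal (f \<theta>)) < ennreal \<kappa>"
    using order_tendstoD(2)[OF assms(1), of "ennreal \<kappa>"] \<open>0 < \<kappa>\<close> by simp
  then have "\<forall>\<^sub>F M in at_top. 0 < M \<and> (SUP \<theta>\<in>\<Theta> - sublevel \<Theta> w M. ennreal (f \<theta>)) < ennreal \<kappa>"
    by (intro eventually_conj eventually_gt_at_top)
  then obtain M where M: "0 < M" "(SUP \<theta>\<in>\<Theta> - sublevel \<Theta> w M. ennreal (f \<theta>)) < ennreal \<kappa>"
    using eventually_happens'[of at_top] by (metis (no_types, lifting) trivial_limit_at_top_linorder)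
  have "f \<theta> < \<kappa>" if "\<theta> \<in> \<Theta>" "M < w \<theta>" for \<theta>
  proof -
    have "\<theta> \<in> \<Theta> - sublevel \<Theta> w M"
      using that by (simp add: sublevel_def)
    then have "ennreal (f \<theta>) < ennreal \<kappa>"
      using M(2) by (meson SUP_upper le_less_trans)
    then show ?thesis
      by (metis ennreal_leI not_le)
  qed
  with M(1) show ?thesis by blast
qed

lemma continuous_at_0_lower_bound:
  fixes \<Delta> :: "real \<Rightarrow> real"
  assumes "continuous_on {0..<r} \<Delta>" "0 < r" "l < \<Delta> 0"
  obtains \<eta> where "0 < \<eta>" "\<And>z. 0 \<le> z \<Longrightarrow> z < \<eta> \<Longrightarrow> l < \<Delta> z"
proof -
  have "0 \<in> {0..<r}" "0 < \<Delta> 0 - l"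
    using assms by auto
  then obtain s where s: "0 < s" "\<And>z. z \<in> {0..<r} \<Longrightarrow> dist z 0 < s \<Longrightarrow> dist (\<Delta> z) (\<Delta> 0) < \<Delta> 0 - l"
    using assms(1) unfolding continuous_on_iff by blast
  show ?thesis
  proof
    show "0 < min r s" using s assms by simp
    show "l < \<Delta> z" if "0 \<le> z" "z < min r s" for z
      using s(2)[of z] that by (auto simp: dist_real_def abs_if split: if_splits)
  qed
qed

text \<open>At one fixed point \<open>y\<close> of \<open>X - C\<close>, the integral of
  \<open>V\<close> is nonnegative, so the drift inequality cannot subtract more than
  \<open>V y\<close>. Since \<open>V y powr \<iota>\<close> is at least 1,
  \<open>1 / a \<theta>\<close> is at most \<open>V y\<close>, which does not depend on
  \<open>\<theta>\<close>.\<close>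

lemma drift_x_inverse_bounded:
  assumes "markov_family \<Theta> X P" and "drift_x \<Theta> X P V C a b \<iota>"
  shows "\<exists>A\<ge>0. \<forall>\<theta>\<in>\<Theta>. 1 / a \<theta> \<le> A"
proof -
  obtain y where y: "y \<in> X" "y \<notin> C"
    using assms(2) unfolding drift_x_def by blast
  have V: "\<forall>x\<in>X. 1 \<le> V x"
    using assms(2) unfolding drift_x_def by blast
  have "1 / a \<theta> \<le> V y" if \<theta>: "\<theta> \<in> \<Theta>" for \<theta>
  proof -
    have "P \<theta> \<in> restrict_space borel X \<rightarrow>\<^sub>M prob_algebra (restrict_space borel X)"
      using assms(1) \<theta> unfolding markov_family_def by blast
    moreover have "y \<in> space (restrict_space borel X)"
      using y by (simp add: space_restrict_space)
    ultimately have "P \<theta> y \<in> space (prob_algebra (restrict_space borel X))"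
      by (rule measurable_space)
    then have "sets (P \<theta> y) = sets (restrict_space borel X)"
      unfolding space_prob_algebra by blast
    \<comment> \<open>The bound \<open>1 \<le> V\<close> is known only on \<open>X\<close>, so the
      nonnegativity of the integral relies on the kernel living on \<open>X\<close>.\<close>
    then have "space (P \<theta> y) = X"
      by (simp add: sets_eq_imp_space_eq space_restrict_space)
    then have "0 \<le> kernel_op P \<theta> V y"
      unfolding kernel_op_def using V by (intro Bochner_Integration.integral_nonneg) force
    also have "\<dots> \<le> V y - 1 / a \<theta> * V y powr \<iota>"
      using assms(2) \<theta> y unfolding drift_x_def by (force simp: indicator_def)
    finally have "1 / a \<theta> * V y powr \<iota> \<le> V y" by simp
    moreover have "1 \<le> V y powr \<iota>" "0 < a \<theta>"
      using assms(2) \<theta> y V unfolding drift_x_def by (auto intro: ge_one_powr_ge_zero)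
    ultimately show ?thesis
      using mult_left_mono[of 1 "V y powr \<iota>" "1 / a \<theta>"] by simp
  qed
  moreover have "0 \<le> V y" using V y by force
  ultimately show ?thesis by blast
qed

text \<open>Places every point with non-small argument of \<open>\<Delta>\<close> in one of the sets
  over which the last supremum in \<open>drift_theta\<close> is finite.\<close>

lemma drift_theta_ratio_bounded_below:
  assumes V: "\<forall>x\<in>X. 1 \<le> V x"
    and drift: "drift_theta \<Theta> X P \<phi> \<gamma>max V C a b \<iota> w \<beta> c d e \<Delta> p" and "0 < \<eta>"
  shows "\<exists>\<epsilon>>0. \<forall>\<theta>\<in>\<Theta>. \<forall>x\<in>X. \<eta> \<le> V_beta V c e \<beta> \<theta> x \<longrightarrow> \<epsilon> \<le> V x powr \<beta> / e \<theta>"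
proof -
  have lim: "((\<lambda>M. SUP \<theta>\<in>\<Theta> - sublevel \<Theta> w M. ennreal (max (c \<theta>) (d \<theta>))) \<longlongrightarrow> 0) at_top"
    and ebdd: "\<forall>M>0. bdd_above (e ` sublevel \<Theta> w M)" and ce: "\<forall>\<theta>\<in>\<Theta>. 0 \<le> c \<theta> \<and> 0 \<le> d \<theta> \<and> 1 \<le> e \<theta>" and "0 \<le> \<beta>"
    using drift unfolding drift_theta_def by - (elim conjE, assumption)+
  obtain M where M: "0 < M" "\<And>\<theta>. \<theta> \<in> \<Theta> \<Longrightarrow> M < w \<theta> \<Longrightarrow> max (c \<theta>) (d \<theta>) < \<eta> / 2"
    using SUP_complement_sublevel_tendsto_0D[OF lim, of "\<eta> / 2"] \<open>0 < \<eta>\<close> by auto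
  obtain E where E: "\<And>\<theta>. \<theta> \<in> sublevel \<Theta> w M \<Longrightarrow> e \<theta> \<le> E"
    using ebdd M(1) unfolding bdd_above_def by blast
  \<comment> \<open>The first entry serves \<open>M < w \<theta>\<close>, where
    \<open>c \<theta> < \<eta> / 2\<close> leaves at least \<open>\<eta> / 2\<close> to the ratio.
    The second serves the sublevel set, where \<open>e\<close> is bounded and the numerator is at
    least 1.\<close>
  define \<epsilon> where "\<epsilon> = min (\<eta> / 2) (1 / max E 1)"
  have "\<epsilon> \<le> V x powr \<beta> / e \<theta>" if "\<theta> \<in> \<Theta>" "x \<in> X" "\<eta> \<le> V_beta V c e \<beta> \<theta> x" for \<theta> x
  proof (cases "M < w \<theta>")
    case True
    then show ?thesis using M(2)[of \<theta>] that unfolding \<epsilon>_def V_beta_def by auto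
  next
    case False
    then have "e \<theta> \<le> max E 1"
      using E[of \<theta>] that by (force simp: sublevel_def)
    moreover have "1 \<le> V x powr \<beta>" "1 \<le> e \<theta>"
      using V ce that \<open>0 \<le> \<beta>\<close> by (auto intro: ge_one_powr_ge_zero)
    ultimately have "1 / max E 1 \<le> V x powr \<beta> / e \<theta>"
      by (intro frac_le) auto
    then show ?thesis unfolding \<epsilon>_def by simp
  qed
  moreover have "0 < \<epsilon>" using \<open>0 < \<eta>\<close> unfolding \<epsilon>_def by simp
  ultimately show ?thesis by blast
qed

text \<open>With \<open>u = V x powr \<beta> / e \<theta>\<close> bounded below and \<open>c\<close>
  bounded, both \<open>\<Delta> 0\<close> and \<open>\<Delta>\<close> at
  \<open>c \<theta> + u\<close> are at most constant multiples of \<open>u powr p\<close>. The bound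
  \<open>cond5\<close> then compares \<open>w \<theta> * u powr p\<close> with
  \<open>V x powr \<iota> / a \<theta>\<close>.\<close>

lemma drift_theta_error_bound:
  assumes V: "\<forall>x\<in>X. 1 \<le> V x" and a: "\<forall>\<theta>\<in>\<Theta>. 0 < a \<theta>"
    and drift: "drift_theta \<Theta> X P \<phi> \<gamma>max V C a b \<iota> w \<beta> c d e \<Delta> p" and "0 < \<eta>"
  shows "\<exists>K\<ge>0. \<forall>\<theta>\<in>\<Theta>. \<forall>x\<in>X. \<eta> \<le> V_beta V c e \<beta> \<theta> x \<longrightarrow>
    w \<theta> * (\<Delta> 0 + \<bar>\<Delta> (V_beta V c e \<beta> \<theta> x)\<bar>) \<le> K * (V x powr \<iota> / a \<theta>)"
proof -
  have w: "\<forall>\<theta>\<in>\<Theta>. 1 \<le> w \<theta>" and ce: "\<forall>\<theta>\<in>\<Theta>. 0 \<le> c \<theta> \<and> 0 \<le> d \<theta> \<and> 1 \<le> e \<theta>"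
    and "bounded (c ` \<Theta>)" and \<Delta>0: "0 < \<Delta> 0" and p: "0 < p"
    and growth: "\<forall>M>0. \<exists>K>0. \<forall>z\<ge>M. \<bar>\<Delta> z\<bar> \<le> K * z powr p"
    and cond5: "\<forall>\<epsilon>>0. bdd_above ((\<lambda>(\<theta>, x). a \<theta> * w \<theta> * e \<theta> powr (- p) / V x powr (\<iota> - p * \<beta>))
          ` {(\<theta>, x) \<in> \<Theta> \<times> X. V x powr \<beta> / e \<theta> \<ge> \<epsilon>})"
    using drift unfolding drift_theta_def by - (elim conjE, assumption)+
  obtain \<epsilon> where \<epsilon>: "0 < \<epsilon>"
    "\<And>\<theta> x. \<theta> \<in> \<Theta> \<Longrightarrow> x \<in> X \<Longrightarrow> \<eta> \<le> V_beta V c e \<beta> \<theta> x \<Longrightarrow> \<epsilon> \<le> V x powr \<beta> / e \<theta>"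
    using drift_theta_ratio_bounded_below[OF V drift \<open>0 < \<eta>\<close>] by blast
  obtain G where G: "0 < G" "\<And>z. \<eta> \<le> z \<Longrightarrow> \<bar>\<Delta> z\<bar> \<le> G * z powr p"
    using growth \<open>0 < \<eta>\<close> by blast
  obtain B where B: "\<And>\<theta> x. \<theta> \<in> \<Theta> \<Longrightarrow> x \<in> X \<Longrightarrow> \<epsilon> \<le> V x powr \<beta> / e \<theta> \<Longrightarrow>
      a \<theta> * w \<theta> * e \<theta> powr (- p) / V x powr (\<iota> - p * \<beta>) \<le> B"
    using cond5 \<epsilon>(1) unfolding bdd_above_def by fastforce
  obtain c0 where c0: "0 < c0" "\<And>\<theta>. \<theta> \<in> \<Theta> \<Longrightarrow> c \<theta> \<le> c0"
    using \<open>bounded (c ` \<Theta>)\<close> unfolding bounded_pos by force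
  \<comment> \<open>As \<open>u\<close> is at least \<open>\<epsilon>\<close>,
    \<open>c \<theta> \<le> c0 \<le> c0 / \<epsilon> * u\<close>, whence
    \<open>c \<theta> + u \<le> R * u\<close>.\<close>
  define R where "R = c0 / \<epsilon> + 1"
  \<comment> \<open>The first summand pays for \<open>\<Delta> 0\<close>, the second for the growth
    bound on \<open>\<Delta>\<close>, both in units of \<open>u powr p\<close>.\<close>
  define K where "K = \<Delta> 0 / \<epsilon> powr p + G * R powr p"
  have R: "0 < R" using c0 \<epsilon> unfolding R_def by (simp add: add_pos_pos)
  have K: "0 \<le> K" using G(1) \<Delta>0 unfolding K_def by simp
  \<comment> \<open>\<open>B\<close> is merely an upper bound and may be negative if the set it
    bounds is empty; \<open>max B 0\<close> keeps the constant nonnegative.\<close>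
  have "w \<theta> * (\<Delta> 0 + \<bar>\<Delta> (V_beta V c e \<beta> \<theta> x)\<bar>) \<le> (K * max B 0) * (V x powr \<iota> / a \<theta>)"
    if \<theta>: "\<theta> \<in> \<Theta>" and x: "x \<in> X" and z: "\<eta> \<le> V_beta V c e \<beta> \<theta> x" for \<theta> x
  proof -
    define u where "u = V x powr \<beta> / e \<theta>"
    have pos: "1 \<le> w \<theta>" "1 \<le> e \<theta>" "0 \<le> c \<theta>" "0 < a \<theta>" "1 \<le> V x"
      using w ce a V \<theta> x by auto
    have u: "\<epsilon> \<le> u" using \<epsilon>(2)[OF \<theta> x z] unfolding u_def .
    have "c \<theta> \<le> c0 / \<epsilon> * u"
      using mult_left_mono[OF u, of "c0 / \<epsilon>"] c0(1) c0(2)[OF \<theta>] \<epsilon>(1) by simp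
    then have "V_beta V c e \<beta> \<theta> x \<le> R * u"
      unfolding V_beta_def R_def u_def[symmetric] distrib_right by simp
    then have "V_beta V c e \<beta> \<theta> x powr p \<le> (R * u) powr p"
      using z \<open>0 < \<eta>\<close> p by (intro powr_mono2) auto
    also have "\<dots> = R powr p * u powr p"
      using R u \<epsilon>(1) by (simp add: powr_mult)
    finally have 1: "\<bar>\<Delta> (V_beta V c e \<beta> \<theta> x)\<bar> \<le> G * R powr p * u powr p"
      using order_trans[OF G(2)[OF z] mult_left_mono] G(1) by (simp add: mult.assoc)
    have "\<epsilon> powr p \<le> u powr p"
      using u \<epsilon>(1) p by (intro powr_mono2) auto
    then have "\<Delta> 0 \<le> \<Delta> 0 / \<epsilon> powr p * u powr p"
      using \<epsilon>(1) \<Delta>0 mult_left_mono[of "\<epsilon> powr p" "u powr p" "\<Delta> 0 / \<epsilon> powr p"] by simp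
    with 1 have "\<Delta> 0 + \<bar>\<Delta> (V_beta V c e \<beta> \<theta> x)\<bar> \<le> K * u powr p"
      unfolding K_def by (simp add: distrib_right)
    then have "w \<theta> * (\<Delta> 0 + \<bar>\<Delta> (V_beta V c e \<beta> \<theta> x)\<bar>) \<le> K * (w \<theta> * u powr p)"
      using mult_left_mono[of "\<Delta> 0 + \<bar>\<Delta> (V_beta V c e \<beta> \<theta> x)\<bar>" "K * u powr p" "w \<theta>"] pos
      by (simp add: mult.left_commute)
    \<comment> \<open>Factoring out \<open>V x powr \<iota> / a \<theta>\<close> leaves exactly the
      quantity bounded by \<open>cond5\<close>.\<close>
    also have "w \<theta> * u powr p
        = a \<theta> * w \<theta> * e \<theta> powr (- p) / V x powr (\<iota> - p * \<beta>) * (V x powr \<iota> / a \<theta>)"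
      using pos unfolding u_def
      by (simp add: powr_divide powr_powr powr_diff powr_minus field_simps)
    also have "K * \<dots> \<le> K * (max B 0 * (V x powr \<iota> / a \<theta>))"
      using B[OF \<theta> x] u pos K unfolding u_def
      by (intro mult_left_mono mult_right_mono) auto
    finally show ?thesis by (simp add: mult.assoc)
  qed
  moreover have "0 \<le> K * max B 0" using K by simp
  ultimately show ?thesis by blast
qed

theorem theorem2:
  fixes X :: "'x::euclidean_space set" and \<Theta> :: "'t::euclidean_space set"
    and P :: "'t \<Rightarrow> 'x \<Rightarrow> 'x measure"
    and \<phi> :: "real \<Rightarrow> 't \<Rightarrow> 'x \<Rightarrow> 't"
    and \<gamma>max :: real
    and V :: "'x \<Rightarrow> real" and C :: "'x set" and a b :: "'t \<Rightarrow> real" and \<iota> :: real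
    and w :: "'t \<Rightarrow> real" and \<beta> :: real and c d e :: "'t \<Rightarrow> real"
    and \<Delta> :: "real \<Rightarrow> real" and p :: real and \<epsilon> :: real
  assumes "0 < \<gamma>max"
    and "markov_family \<Theta> X P"
    and "\<forall>\<gamma>\<in>{0<..\<gamma>max}. \<forall>\<theta>\<in>\<Theta>. \<forall>x\<in>X. \<phi> \<gamma> \<theta> x \<in> \<Theta>"
    and "drift_x \<Theta> X P V C a b \<iota>"
    and "drift_theta \<Theta> X P \<phi> \<gamma>max V C a b \<iota> w \<beta> c d e \<Delta> p"
    and "0 < \<epsilon>" and "\<epsilon> < \<Delta> 0"
  shows "\<exists>L\<ge>1. \<exists>\<delta>>0. \<exists>M>0.
    \<forall>(\<gamma>, \<gamma>')\<in>step_pairs \<gamma>max \<Delta> \<epsilon>. \<forall>(\<theta>, x)\<in>\<Theta> \<times> X - sublevel \<Theta> w M \<times> C.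
      integrable (P \<theta> x) (\<lambda>y. L * V y + w (\<phi> \<gamma> \<theta> y) / \<gamma>) \<and>
      controlled_op P \<phi> \<gamma> (\<lambda>\<theta> x. L * V x + w \<theta> / \<gamma>) \<theta> x
        \<le> L * V x + w \<theta> / \<gamma>' - \<delta> * (V x powr \<iota> / a \<theta> + w \<theta>)"
proof -
  have V: "\<forall>x\<in>X. 1 \<le> V x" and Cbdd: "bdd_above (V ` C)"
    and a: "\<forall>\<theta>\<in>\<Theta>. 0 < a \<theta> \<and> 0 \<le> b \<theta>" and \<iota>: "0 \<le> \<iota>"
    and PV: "\<forall>\<theta>\<in>\<Theta>. \<forall>x\<in>X. integrable (P \<theta> x) V \<and>
        (\<integral>y. V y \<partial>P \<theta> x)
          \<le> (V x - (1 / a \<theta>) * V x powr \<iota>) * indicator (- C) x + b \<theta> * indicator C x"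
    using assms(4) unfolding drift_x_def kernel_op_def by - (elim conjE, assumption)+
  have w: "\<forall>\<theta>\<in>\<Theta>. 1 \<le> w \<theta>" and ce: "\<forall>\<theta>\<in>\<Theta>. 0 \<le> c \<theta> \<and> 0 \<le> d \<theta> \<and> 1 \<le> e \<theta>"
    and blim: "((\<lambda>M. SUP \<theta>\<in>\<Theta> - sublevel \<Theta> w M. ennreal (b \<theta> / w \<theta>)) \<longlongrightarrow> 0) at_top"
    and dlim: "((\<lambda>M. SUP \<theta>\<in>\<Theta> - sublevel \<Theta> w M. ennreal (max (c \<theta>) (d \<theta>))) \<longlongrightarrow> 0) at_top"
    and cont: "\<exists>r>0. continuous_on {0..<r} \<Delta>"
    and Pw: "\<forall>\<gamma>\<in>{0<..\<gamma>max}. \<forall>\<theta>\<in>\<Theta>. \<forall>x\<in>X.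
        integrable (P \<theta> x) (\<lambda>y. w (\<phi> \<gamma> \<theta> y)) \<and>
        (\<integral>y. w (\<phi> \<gamma> \<theta> y) \<partial>P \<theta> x) \<le> w \<theta> - \<gamma> * w \<theta> *
          \<Delta> (V_beta V c e \<beta> \<theta> x * indicator (- C) x + d \<theta> * indicator C x)"
    using assms(5) unfolding drift_theta_def controlled_op_def by - (elim conjE, assumption)+
  obtain r where r: "0 < r" "continuous_on {0..<r} \<Delta>"
    using cont by blast
  \<comment> \<open>Below \<open>\<eta>\<close>, half of the slack \<open>\<epsilon>\<close>
    survives as a negative drift \<open>- (\<epsilon> / 2 * w \<theta>)\<close>.\<close>
  obtain \<eta> where \<eta>: "0 < \<eta>" "\<And>z. 0 \<le> z \<Longrightarrow> z < \<eta> \<Longrightarrow> \<Delta> 0 - \<epsilon> / 2 < \<Delta> z"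
    using continuous_at_0_lower_bound[OF r(2,1), of "\<Delta> 0 - \<epsilon> / 2"] \<open>0 < \<epsilon>\<close> by auto
  obtain K where K: "0 \<le> K" "\<And>\<theta> x. \<theta> \<in> \<Theta> \<Longrightarrow> x \<in> X \<Longrightarrow> \<eta> \<le> V_beta V c e \<beta> \<theta> x \<Longrightarrow>
      w \<theta> * (\<Delta> 0 + \<bar>\<Delta> (V_beta V c e \<beta> \<theta> x)\<bar>) \<le> K * (V x powr \<iota> / a \<theta>)"
    using drift_theta_error_bound[OF V _ assms(5) \<eta>(1)] a by blast
  obtain A where A: "0 \<le> A" "\<And>\<theta>. \<theta> \<in> \<Theta> \<Longrightarrow> 1 / a \<theta> \<le> A"
    using drift_x_inverse_bounded[OF assms(2,4)] by blast
  obtain v where v: "\<And>x. x \<in> C \<Longrightarrow> V x \<le> v"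
    using Cbdd unfolding bdd_above_def by blast
  \<comment> \<open>\<open>S\<close> bounds \<open>V x powr \<iota> / a \<theta>\<close> for
    \<open>x\<close> in \<open>C\<close>, uniformly in \<open>\<theta>\<close>.\<close>
  define S where "S = max 1 v powr \<iota> * A"
  \<comment> \<open>On \<open>C\<close> the drift \<open>\<epsilon> / 2 * w \<theta>\<close> is
    spent as 1/4 + 1/8 + 1/8 of \<open>\<epsilon> * w \<theta>\<close>: on
    \<open>L * b \<theta>\<close>, on \<open>\<delta> * w \<theta>\<close> and on
    \<open>\<delta>\<close> times the bound \<open>S\<close>.\<close>
  define \<delta> where "\<delta> = \<epsilon> / (8 * (S + 1))"
  have "0 \<le> S" using A(1) unfolding S_def by simp
  then have \<delta>: "0 < \<delta>" "\<delta> \<le> \<epsilon> / 8" "\<delta> * S \<le> \<epsilon> / 8"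
    using \<open>0 < \<epsilon>\<close> unfolding \<delta>_def by (auto simp: field_simps)
  \<comment> \<open>Outside \<open>C\<close> the drift of \<open>L * V\<close> must cover the error
    with factor \<open>K\<close> and the claimed decrease with factor \<open>\<delta>\<close>; the 1
    ensures \<open>1 \<le> L\<close>.\<close>
  define L where "L = K + \<delta> + 1"
  have L: "1 \<le> L" using K(1) \<delta>(1) unfolding L_def by simp
  \<comment> \<open>This threshold depends on \<open>L\<close>, so it is chosen after it; the
    resulting bound is \<open>L * b \<theta> \<le> \<epsilon> / 4 * w \<theta>\<close>.\<close>
  obtain M1 where M1: "0 < M1" "\<And>\<theta>. \<theta> \<in> \<Theta> \<Longrightarrow> M1 < w \<theta> \<Longrightarrow> b \<theta> / w \<theta> < \<epsilon> / (4 * L)"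
    using SUP_complement_sublevel_tendsto_0D[OF blim, of "\<epsilon> / (4 * L)"] \<open>0 < \<epsilon>\<close> L by auto
  obtain M2 where M2: "0 < M2" "\<And>\<theta>. \<theta> \<in> \<Theta> \<Longrightarrow> M2 < w \<theta> \<Longrightarrow> max (c \<theta>) (d \<theta>) < \<eta>"
    using SUP_complement_sublevel_tendsto_0D[OF dlim \<eta>(1)] by auto
  define M where "M = max M1 M2"
  have "integrable (P \<theta> x) (\<lambda>y. L * V y + w (\<phi> \<gamma> \<theta> y) / \<gamma>) \<and>
      controlled_op P \<phi> \<gamma> (\<lambda>\<theta> x. L * V x + w \<theta> / \<gamma>) \<theta> x
        \<le> L * V x + w \<theta> / \<gamma>' - \<delta> * (V x powr \<iota> / a \<theta> + w \<theta>)"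
    if steps: "(\<gamma>, \<gamma>') \<in> step_pairs \<gamma>max \<Delta> \<epsilon>" and "(\<theta>, x) \<in> \<Theta> \<times> X - sublevel \<Theta> w M \<times> C"
    for \<gamma> \<gamma>' \<theta> x
  proof -
    have \<theta>: "\<theta> \<in> \<Theta>" and x: "x \<in> X" and out: "x \<in> C \<Longrightarrow> M < w \<theta>"
      using that(2) by (auto simp: sublevel_def)
    have \<gamma>: "\<gamma> \<in> {0<..\<gamma>max}" "1 / \<gamma> - 1 / \<gamma>' < \<Delta> 0 - \<epsilon>"
      using steps unfolding step_pairs_def by auto
    define D where "D = \<Delta> (V_beta V c e \<beta> \<theta> x * indicator (- C) x + d \<theta> * indicator C x)"
    define Y where "Y = V x powr \<iota> / a \<theta>"
    have pos: "1 \<le> w \<theta>" "1 \<le> e \<theta>" "0 \<le> c \<theta>" "0 \<le> d \<theta>" "0 < a \<theta>" "1 \<le> V x"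
      using w ce a V \<theta> x by auto
    have Y: "0 \<le> Y" using pos unfolding Y_def by simp
    have int: "integrable (P \<theta> x) V" "integrable (P \<theta> x) (\<lambda>y. w (\<phi> \<gamma> \<theta> y))"
      using PV[rule_format, OF \<theta> x] Pw[rule_format, OF \<gamma>(1) \<theta> x] by auto
    have "(\<integral>y. w (\<phi> \<gamma> \<theta> y) \<partial>P \<theta> x) / \<gamma> \<le> (w \<theta> - \<gamma> * w \<theta> * D) / \<gamma>"
      using Pw[rule_format, OF \<gamma>(1) \<theta> x] \<gamma>(1) unfolding D_def by (intro divide_right_mono) auto
    also have "\<dots> = w \<theta> * (1 / \<gamma>) - w \<theta> * D"
      using \<gamma>(1) by (simp add: field_simps)
    also have "\<dots> \<le> w \<theta> * (1 / \<gamma>' + (\<Delta> 0 - \<epsilon>)) - w \<theta> * D"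
      using \<gamma>(2) pos by (intro diff_right_mono mult_left_mono) auto
    finally have Pw_le: "(\<integral>y. w (\<phi> \<gamma> \<theta> y) \<partial>P \<theta> x) / \<gamma> \<le> w \<theta> / \<gamma>' + w \<theta> * (\<Delta> 0 - \<epsilon> - D)"
      by (simp add: algebra_simps)
    have small: "w \<theta> * (\<Delta> 0 - \<epsilon> - \<Delta> z) \<le> - (\<epsilon> / 2 * w \<theta>)" if "0 \<le> z" "z < \<eta>" for z
      using mult_left_mono[of "\<Delta> 0 - \<epsilon> - \<Delta> z" "- (\<epsilon> / 2)" "w \<theta>"] \<eta>(2)[OF that] pos
      by (simp add: mult.commute)
    have \<delta>w: "\<delta> * w \<theta> \<le> \<epsilon> / 8 * w \<theta>"
      using \<delta>(2) pos by (intro mult_right_mono) auto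
    \<comment> \<open>The term \<open>w \<theta> / \<gamma>'\<close> has been split off, so what
      remains is free of both step sizes. This makes the constants uniform over
      \<open>step_pairs\<close>.\<close>
    have key: "L * (\<integral>y. V y \<partial>P \<theta> x) + w \<theta> * (\<Delta> 0 - \<epsilon> - D) \<le> L * V x - \<delta> * (Y + w \<theta>)"
    proof (cases "x \<in> C")
      case False
      let ?z = "V_beta V c e \<beta> \<theta> x"
      have D: "D = \<Delta> ?z" using False by (simp add: D_def)
      have "(\<integral>y. V y \<partial>P \<theta> x) \<le> V x - Y"
        using PV[rule_format, OF \<theta> x] False by (simp add: Y_def)
      then have LV: "L * (\<integral>y. V y \<partial>P \<theta> x) \<le> L * V x - L * Y"
        using L mult_left_mono[of _ "V x - Y" L] by (fastforce simp: right_diff_distrib)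
      \<comment> \<open>Including \<open>\<delta> * w \<theta>\<close> here leaves only multiples of
        \<open>Y\<close> to compare with \<open>L * Y\<close>.\<close>
      have "w \<theta> * (\<Delta> 0 - \<epsilon> - D) + \<delta> * w \<theta> \<le> K * Y"
      proof (cases "?z < \<eta>")
        case True
        have "0 \<le> ?z" using pos by (simp add: V_beta_def)
        then have "w \<theta> * (\<Delta> 0 - \<epsilon> - D) \<le> - (\<epsilon> / 2 * w \<theta>)"
          using small True D by simp
        moreover have "0 \<le> \<epsilon> * w \<theta>" "0 \<le> K * Y" using \<open>0 < \<epsilon>\<close> pos K(1) Y by auto
        ultimately show ?thesis using \<delta>w by linarith
      next
        case False
        have "w \<theta> * (\<Delta> 0 - \<epsilon> - D + \<delta>) \<le> w \<theta> * (\<Delta> 0 + \<bar>D\<bar>)"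
          using pos \<delta>(2) \<open>0 < \<epsilon>\<close> by (intro mult_left_mono) auto
        also have "\<dots> \<le> K * Y"
          using K(2)[OF \<theta> x] False unfolding Y_def D by auto
        finally show ?thesis by (simp add: algebra_simps)
      qed
      with LV Y show ?thesis unfolding L_def by (simp add: algebra_simps)
    next
      case True
      have large: "M1 < w \<theta>" "M2 < w \<theta>" using out[OF True] unfolding M_def by auto
      have "D = \<Delta> (d \<theta>)" using True by (simp add: D_def)
      then have err: "w \<theta> * (\<Delta> 0 - \<epsilon> - D) \<le> - (\<epsilon> / 2 * w \<theta>)"
        using small[of "d \<theta>"] M2(2)[OF \<theta> large(2)] pos by simp
      have "(\<integral>y. V y \<partial>P \<theta> x) \<le> b \<theta>" using PV[rule_format, OF \<theta> x] True by simp
      then have "L * (\<integral>y. V y \<partial>P \<theta> x) \<le> L * b \<theta>" using L by (intro mult_left_mono) auto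
      also have "\<dots> \<le> \<epsilon> / 4 * w \<theta>"
        using M1(2)[OF \<theta> large(1)] L pos by (simp add: field_simps)
      finally have LV: "L * (\<integral>y. V y \<partial>P \<theta> x) \<le> \<epsilon> / 4 * w \<theta>" .
      have "V x powr \<iota> \<le> max 1 v powr \<iota>"
        using v[OF True] pos \<iota> by (intro powr_mono2) auto
      then have "Y \<le> S"
        using mult_mono[of "V x powr \<iota>" "max 1 v powr \<iota>" "1 / a \<theta>" A] A(2)[OF \<theta>] pos
        unfolding Y_def S_def by simp
      then have "\<delta> * Y \<le> \<epsilon> / 8"
        using \<delta> mult_left_mono[of Y S \<delta>] by linarith
      also have "\<dots> \<le> \<epsilon> / 8 * w \<theta>" using \<open>0 < \<epsilon>\<close> pos by simp
      finally have "\<delta> * Y \<le> \<epsilon> / 8 * w \<theta>" .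
      moreover have "0 \<le> L * V x" using L pos by simp
      ultimately show ?thesis
        using err LV \<delta>w unfolding distrib_left by linarith
    qed
    have "controlled_op P \<phi> \<gamma> (\<lambda>\<theta> x. L * V x + w \<theta> / \<gamma>) \<theta> x
        = L * (\<integral>y. V y \<partial>P \<theta> x) + (\<integral>y. w (\<phi> \<gamma> \<theta> y) \<partial>P \<theta> x) / \<gamma>"
      unfolding controlled_op_def using int by simp
    with key Pw_le int show ?thesis unfolding Y_def by auto
  qed
  moreover have "0 < M" using M1(1) unfolding M_def by simp
  ultimately show ?thesis
    using L \<delta>(1) by (intro exI[of _ L] exI[of _ \<delta>] exI[of _ M] conjI) auto
qed

end
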